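(* Let $G$ be a locally compact abelian group and let $\mu$ be a weakly almost periodic measure on $G$ supported on a set with finite local complexity (FLC). Let $\mu=\mu_{\mathsf{s}}+\mu_0$ be its Eberlein decomposition. Then $\mu_{\mathsf{s}}$ and $\mu_0$ are pure point measures and $\operatorname{supp}(\mu_{\mathsf{s}})$ has FLC.
   Context: A set $\Lambda\subset G$ has finite local complexity (FLC) if $\Lambda-\Lambda$ is locally finite, i.e. $(\Lambda-\Lambda)\cap K$ is finite for every compact $K\subset G$. $C_c(G)$: continuous compactly supported functions on $G$; $C_u(G)$: Banach space of bounded uniformly continuous complex functions, sup norm. $\theta_G$ (also $dt$) is Haar measure. Measures are (complex) Radon measures on $G$. $\mu$ is translation bounded if $\sup_{x\in G}|\mu|(x+K)<\infty$ for all compact $K$ ($|\mu|$ the variation). $(c*\mu)(x)=\int_G c(x-t)\,d\mu(t)$; $T^tf(x)=f(x-t)$. $f\in C_u(G)$ is Bohr (resp. weakly) almost periodic if $\{T^tf:t\in G\}$ is precompact in the norm (resp. weak) topology of $C_u(G)$. $G$ is assumed to admit Følner sequences: sequences $(A_n)$ of compact sets of positive measure with $\theta_G(A_n\triangle(x+A_n))/\theta_G(A_n)\to0$ for all $x\in G$. Every weakly almost periodic $f$ has a mean $M(f)=\lim_n\frac1{\theta_G(A_n)}\int_{x+A_n}f(t)\,dt$, uniformly in $x\in G$, independent of the Følner sequence; $f$ is null weakly almost periodic if moreover $M(|f|)=0$. A translation bounded measure $\mu$ is strongly, weakly, resp. null weakly almost periodic ($\mu\in\mathcal{SAP}(G)$,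 $\mathcal{WAP}(G)$, $\mathcal{WAP}_0(G)$) if for all $c\in C_c(G)$ the function $c*\mu$ is Bohr, weakly, resp. null weakly almost periodic. One has $\mathcal{WAP}(G)=\mathcal{SAP}(G)\oplus\mathcal{WAP}_0(G)$; the Eberlein decomposition of $\mu\in\mathcal{WAP}(G)$ is the unique decomposition $\mu=\mu_{\mathsf{s}}+\mu_0$ with $\mu_{\mathsf{s}}\in\mathcal{SAP}(G)$, $\mu_0\in\mathcal{WAP}_0(G)$. *)

theory Defs
  imports "HOL-Analysis.Analysis"
begin

text \<open>
  Throughout, the group \<open>G\<close> is the universe of a type of class
  \<open>{topological_ab_group_add, t2_space}\<close>; local compactness is a separate
  hypothesis (\<open>locally_compact_space euclidean\<close>).
\<close>

section \<open>Sets, test functions, Haar measure, means\<close>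

definition locally_finite :: "'a::topological_space set \<Rightarrow> bool" where
  "locally_finite S \<longleftrightarrow> (\<forall>K. compact K \<longrightarrow> finite (S \<inter> K))"

definition FLC :: "'a::topological_ab_group_add set \<Rightarrow> bool" where
  "FLC \<Lambda> \<longleftrightarrow> locally_finite {x - y | x y. x \<in> \<Lambda> \<and> y \<in> \<Lambda>}"

definition fun_supp :: "('a::topological_space \<Rightarrow> 'b::zero) \<Rightarrow> 'a set" where
  "fun_supp f = closure {x. f x \<noteq> 0}"

definition Cc :: "('a::topological_space \<Rightarrow> 'b::real_normed_vector) set" where
  "Cc = {f. continuous_on UNIV f \<and> compact (fun_supp f)}"

definition haar_measure :: "'a::topological_ab_group_add measure \<Rightarrow> bool" where
  "haar_measure \<theta> \<longleftrightarrow>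
     sets \<theta> = sets borel \<and> emeasure \<theta> UNIV \<noteq> 0 \<and>
     (\<forall>K. compact K \<longrightarrow> emeasure \<theta> K < \<infinity>) \<and>
     (\<forall>B\<in>sets borel. emeasure \<theta> B = (INF U\<in>{U. open U \<and> B \<subseteq> U}. emeasure \<theta> U)) \<and>
     (\<forall>U. open U \<longrightarrow> emeasure \<theta> U = (SUP K\<in>{K. compact K \<and> K \<subseteq> U}. emeasure \<theta> K)) \<and>
     (\<forall>x. \<forall>B\<in>sets borel. emeasure \<theta> ((+) x ` B) = emeasure \<theta> B)"

definition folner :: "'a::topological_ab_group_add measure \<Rightarrow> (nat \<Rightarrow> 'a set) \<Rightarrow> bool" where
  "folner \<theta> A \<longleftrightarrow>
     (\<forall>n. compact (A n) \<and> 0 < measure \<theta> (A n)) \<and>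
     (\<forall>x. (\<lambda>n. measure \<theta> ((A n - (+) x ` A n) \<union> ((+) x ` A n - A n)) / measure \<theta> (A n))
            \<longlonglongrightarrow> 0)"

text \<open>
  \<open>has_mean \<theta> f m\<close> says \<open>M(f) = m\<close>: the averages converge to \<open>m\<close>, uniformly in the
  translation, along every Foelner sequence.
\<close>

definition has_mean ::
  "'a::topological_ab_group_add measure \<Rightarrow> ('a \<Rightarrow> complex) \<Rightarrow> complex \<Rightarrow> bool" where
  "has_mean \<theta> f m \<longleftrightarrow>
     (\<forall>A. folner \<theta> A \<longrightarrow>
        uniform_limit UNIV
          (\<lambda>n x. (LINT t:((+) x ` A n)|\<theta>. f t) / of_real (measure \<theta> (A n)))
          (\<lambda>_. m) sequentially)"


section \<open>Almost periodic functions\<close>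

text \<open>
  The Banach space \<open>C\<^sub>u(G)\<close> is a closed subspace of the library's space
  \<open>G \<Rightarrow>\<^sub>C complex\<close> of bounded continuous functions with the sup norm.
\<close>

definition Cu :: "('a::topological_ab_group_add \<Rightarrow>\<^sub>C complex) set" where
  "Cu = {f :: 'a \<Rightarrow>\<^sub>C complex. \<forall>e>0. \<exists>U. open U \<and> 0 \<in> U \<and> (\<forall>x y. x - y \<in> U \<longrightarrow> cmod (f x - f y) < e)}"

definition Cu_dual :: "(('a::topological_ab_group_add \<Rightarrow>\<^sub>C complex) \<Rightarrow> complex) set" where
  "Cu_dual = {\<phi>.
     (\<forall>f\<in>Cu. \<forall>g\<in>Cu. \<forall>h\<in>Cu. \<forall>a.
        (\<forall>x. apply_bcontfun h x = a * apply_bcontfun f x + apply_bcontfun g x) \<longrightarrow>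
        \<phi> h = a * \<phi> f + \<phi> g) \<and>
     (\<exists>B. \<forall>f\<in>(Cu :: ('a \<Rightarrow>\<^sub>C complex) set). cmod (\<phi> f) \<le> B * norm f)}"

definition Cu_norm_topology :: "('a::topological_ab_group_add \<Rightarrow>\<^sub>C complex) topology" where
  "Cu_norm_topology = top_of_set Cu"

definition Cu_weak_topology :: "('a::topological_ab_group_add \<Rightarrow>\<^sub>C complex) topology" where
  "Cu_weak_topology =
     topology_generated_by {{f \<in> Cu. \<phi> f \<in> V} | \<phi> V. \<phi> \<in> Cu_dual \<and> open V}"

definition precompact_in :: "'b topology \<Rightarrow> 'b set \<Rightarrow> bool" where
  "precompact_in X S \<longleftrightarrow> S \<subseteq> topspace X \<and> compactin X (X closure_of S)"

definition translate ::
  "'a::topological_ab_group_add \<Rightarrow> ('a \<Rightarrow>\<^sub>C complex) \<Rightarrow> ('a \<Rightarrow>\<^sub>C complex)" where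
  "translate t f = Bcontfun (\<lambda>x. f (x - t))"

lemma translate_apply: "translate t f x = f (x - t)"
proof -
  have "(\<lambda>x. apply_bcontfun f (x - t)) \<in> bcontfun"
  proof (rule bcontfun_normI)
    show "continuous_on UNIV (\<lambda>x. apply_bcontfun f (x - t))"
      by (intro continuous_on_compose2[OF continuous_on_apply_bcontfun[of UNIV f]]
          continuous_intros) auto
    show "norm (apply_bcontfun f (x - t)) \<le> norm f" for x
      by (rule norm_bounded)
  qed
  then show ?thesis
    by (simp add: translate_def Bcontfun_inverse)
qed

definition bohr_ap :: "('a::topological_ab_group_add \<Rightarrow>\<^sub>C complex) \<Rightarrow> bool" where
  "bohr_ap f \<longleftrightarrow> f \<in> Cu \<and> precompact_in Cu_norm_topology (range (\<lambda>t. translate t f))"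

definition weak_ap :: "('a::topological_ab_group_add \<Rightarrow>\<^sub>C complex) \<Rightarrow> bool" where
  "weak_ap f \<longleftrightarrow> f \<in> Cu \<and> precompact_in Cu_weak_topology (range (\<lambda>t. translate t f))"

definition null_weak_ap ::
  "'a::topological_ab_group_add measure \<Rightarrow> ('a \<Rightarrow>\<^sub>C complex) \<Rightarrow> bool" where
  "null_weak_ap \<theta> f \<longleftrightarrow> weak_ap f \<and> has_mean \<theta> (\<lambda>x. of_real (cmod (f x))) 0"


section \<open>Complex Radon measures\<close>

text \<open>
  A complex Radon measure is, as usual, a linear functional on \<open>C\<^sub>c(G)\<close> that is bounded
  on functions supported in a fixed compact set (such a measure need not have finite total
  variation, so it is not a complex-valued set function on all Borel sets).
  Values outside \<open>Cc\<close> are irrelevant, and two measures are equal iff they agree on \<open>Cc\<close>.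
\<close>

type_synonym 'a functional = "('a \<Rightarrow> complex) \<Rightarrow> complex"

definition radon_measure :: "'a::topological_space functional \<Rightarrow> bool" where
  "radon_measure \<mu> \<longleftrightarrow>
     (\<forall>f\<in>Cc. \<forall>g\<in>Cc. \<forall>a. \<mu> (\<lambda>x. a * f x + g x) = a * \<mu> f + \<mu> g) \<and>
     (\<forall>K. compact K \<longrightarrow>
        (\<exists>B. \<forall>f\<in>Cc. \<forall>b. fun_supp f \<subseteq> K \<and> (\<forall>x. cmod (f x) \<le> b) \<longrightarrow> cmod (\<mu> f) \<le> B * b))"

definition equal_measures ::
  "'a::topological_space functional \<Rightarrow> 'a functional \<Rightarrow> bool" where
  "equal_measures \<mu> \<nu> \<longleftrightarrow> (\<forall>f\<in>Cc. \<mu> f = \<nu> f)"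

text \<open>
  The variation \<open>|\<mu>|\<close>: first as a positive functional on the nonnegative functions in
  \<open>C\<^sub>c(G)\<close>, then as a set function by the Riesz formulas (on open sets by inner
  approximation with test functions, on arbitrary sets by outer regularity).
\<close>

definition variation_fun :: "'a::topological_space functional \<Rightarrow> ('a \<Rightarrow> real) \<Rightarrow> ennreal" where
  "variation_fun \<mu> p = (SUP f\<in>{f\<in>Cc. \<forall>x. cmod (f x) \<le> p x}. ennreal (cmod (\<mu> f)))"

definition variation_open :: "'a::topological_space functional \<Rightarrow> 'a set \<Rightarrow> ennreal" where
  "variation_open \<mu> U =
     (SUP p\<in>{p\<in>Cc. (\<forall>x. 0 \<le> p x \<and> p x \<le> 1) \<and> fun_supp p \<subseteq> U}. variation_fun \<mu> p)"

definition variation :: "'a::topological_space functional \<Rightarrow> 'a set \<Rightarrow> ennreal" where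
  "variation \<mu> A = (INF U\<in>{U. open U \<and> A \<subseteq> U}. variation_open \<mu> U)"

definition translation_bounded :: "'a::topological_ab_group_add functional \<Rightarrow> bool" where
  "translation_bounded \<mu> \<longleftrightarrow>
     (\<forall>K. compact K \<longrightarrow> (SUP x. variation \<mu> ((+) x ` K)) < \<infinity>)"

definition measure_supp :: "'a::topological_space functional \<Rightarrow> 'a set" where
  "measure_supp \<mu> = - \<Union>{U. open U \<and> (\<forall>f\<in>Cc. fun_supp f \<subseteq> U \<longrightarrow> \<mu> f = 0)}"

definition dirac :: "'a \<Rightarrow> 'a functional" where
  "dirac x f = f x"

text \<open>
  \<open>\<mu> = \<Sum>\<^sub>x w(x) \<delta>\<^sub>x\<close>, the series converging unconditionally against every test function;
  then necessarily \<open>w(x) = \<mu>({x})\<close>.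
\<close>

definition pure_point :: "'a::topological_space functional \<Rightarrow> bool" where
  "pure_point \<mu> \<longleftrightarrow> (\<exists>w. \<forall>f\<in>Cc. ((\<lambda>x. w x * dirac x f) has_sum \<mu> f) UNIV)"

definition convolve ::
  "('a \<Rightarrow> complex) \<Rightarrow> 'a::topological_ab_group_add functional \<Rightarrow> 'a \<Rightarrow> complex" where
  "convolve c \<mu> x = \<mu> (\<lambda>t. c (x - t))"

definition SAP :: "'a::topological_ab_group_add functional set" where
  "SAP = {\<mu>. radon_measure \<mu> \<and> translation_bounded \<mu> \<and>
     (\<forall>c\<in>Cc. \<exists>f. apply_bcontfun f = convolve c \<mu> \<and> bohr_ap f)}"

definition WAP :: "'a::topological_ab_group_add functional set" where
  "WAP = {\<mu>. radon_measure \<mu> \<and> translation_bounded \<mu> \<and>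
     (\<forall>c\<in>Cc. \<exists>f. apply_bcontfun f = convolve c \<mu> \<and> weak_ap f)}"

definition WAP0 :: "'a::topological_ab_group_add measure \<Rightarrow> 'a functional set" where
  "WAP0 \<theta> = {\<mu>. radon_measure \<mu> \<and> translation_bounded \<mu> \<and>
     (\<forall>c\<in>Cc. \<exists>f. apply_bcontfun f = convolve c \<mu> \<and> null_weak_ap \<theta> f)}"

definition eberlein_decomposition ::
  "'a::topological_ab_group_add measure \<Rightarrow>
     'a functional \<Rightarrow> 'a functional \<Rightarrow> 'a functional \<Rightarrow> bool" where
  "eberlein_decomposition \<theta> \<mu> \<mu>\<^sub>s \<mu>\<^sub>0 \<longleftrightarrow>
     \<mu>\<^sub>s \<in> SAP \<and> \<mu>\<^sub>0 \<in> WAP0 \<theta> \<and> equal_measures \<mu> (\<lambda>f. \<mu>\<^sub>s f + \<mu>\<^sub>0 f)"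

end

theory Submission
  imports Defs
begin

text \<open>
  Suppose \<open>x, y\<close> lie in the support of \<open>\<mu>\<^sub>s\<close> but \<open>x - y\<close> is not in the closed set \<open>\<Lambda> - \<Lambda>\<close>.
  Test functions \<open>f, g\<close> concentrated near \<open>x, y\<close>, with \<open>\<mu>\<^sub>s f \<noteq> 0 \<noteq> \<mu>\<^sub>s g\<close>, can be chosen so that
  no translate of \<open>\<Lambda>\<close> meets both supports. Hence the functions \<open>F, G\<close> sending \<open>s\<close> to \<open>\<mu>\<close> of the
  translates by \<open>s\<close> of \<open>f, g\<close> satisfy \<open>F G = 0\<close>. In terms of the Eberlein decompositions
  \<open>F = F\<^sub>s + F\<^sub>0\<close>, \<open>G = G\<^sub>s + G\<^sub>0\<close> this bounds \<open>|F\<^sub>s G\<^sub>s|\<close> by a multiple of \<open>|F\<^sub>0| + |G\<^sub>0|\<close>, which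
  has mean zero. As \<open>F\<^sub>s\<close> and \<open>G\<^sub>s\<close> are Bohr almost periodic, \<open>F\<^sub>s G\<^sub>s = 0\<close>, contradicting
  \<open>F\<^sub>s(0) G\<^sub>s(0) = \<mu>\<^sub>s f \<cdot> \<mu>\<^sub>s g\<close>. So the differences of \<open>supp \<mu>\<^sub>s\<close> lie in \<open>\<Lambda> - \<Lambda>\<close>, and a Radon measure
  with locally finite support is pure point.
\<close>

section \<open>Locally finite sets and finite local complexity\<close>

lemma compact_neighbourhood:
  assumes "locally_compact_space (euclidean :: 'a::t2_space topology)"
  obtains U K where "open U" "compact K" "(x::'a) \<in> U" "U \<subseteq> K"
proof -
  have "\<exists>U K. open U \<and> compact K \<and> x \<in> U \<and> U \<subseteq> K"
    using assms by (simp add: locally_compact_space_def)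
  then show thesis
    using that by blast
qed

text \<open>A point outside \<open>S\<close> has a neighbourhood inside a compact set, which meets
  \<open>S\<close> in finitely many points only; these can be deleted from the
  neighbourhood.\<close>

lemma locally_finite_imp_closed:
  fixes S :: "'a::t2_space set"
  assumes "locally_compact_space (euclidean :: 'a topology)" and "locally_finite S"
  shows "closed S"
proof -
  have "\<exists>T. open T \<and> x \<in> T \<and> T \<subseteq> - S" if "x \<notin> S" for x
  proof -
    obtain U K where UK: "open U" "compact K" "x \<in> U" "U \<subseteq> K"
      using compact_neighbourhood[OF assms(1)] by metis
    have "finite (S \<inter> K)"
      using assms(2) UK(2) by (simp add: locally_finite_def)
    then have "open (U - S \<inter> K)"
      using UK(1) by (intro open_Diff finite_imp_closed)
    then show ?thesis
      using UK that by (intro exI[of _ "U - S \<inter> K"]) auto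
  qed
  then show ?thesis
    unfolding closed_def open_subopen[of "- S"] by auto
qed

lemma locally_finite_subset:
  assumes "locally_finite T" and "S \<subseteq> T"
  shows "locally_finite S"
  unfolding locally_finite_def
proof (intro allI impI)
  fix K :: "'a set"
  assume "compact K"
  then have "finite (T \<inter> K)"
    using assms(1) by (simp add: locally_finite_def)
  then show "finite (S \<inter> K)"
    by (rule rev_finite_subset) (use assms(2) in auto)
qed

text \<open>Subtracting one fixed point of \<open>\<Lambda>\<close> embeds \<open>\<Lambda>\<close>
  in its difference set and maps compact sets to compact sets.\<close>

lemma FLC_imp_locally_finite:
  fixes \<Lambda> :: "'a::{topological_ab_group_add, t2_space} set"
  assumes "FLC \<Lambda>"
  shows "locally_finite \<Lambda>"
  unfolding locally_finite_def
proof (intro allI impI)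
  fix K :: "'a set"
  assume K: "compact K"
  show "finite (\<Lambda> \<inter> K)"
  proof (cases "\<Lambda> = {}")
    case False
    then obtain y where y: "y \<in> \<Lambda>"
      by auto
    let ?D = "{x - y | x y. x \<in> \<Lambda> \<and> y \<in> \<Lambda>}"
    have "compact ((\<lambda>x. x - y) ` K)"
      using K by (intro compact_continuous_image continuous_intros)
    then have "finite (?D \<inter> (\<lambda>x. x - y) ` K)"
      using assms by (simp add: FLC_def locally_finite_def)
    moreover have "(\<lambda>x. x - y) ` (\<Lambda> \<inter> K) \<subseteq> ?D \<inter> (\<lambda>x. x - y) ` K"
      using y by auto
    ultimately have "finite ((\<lambda>x. x - y) ` (\<Lambda> \<inter> K))"
      by (rule rev_finite_subset)
    then show ?thesis
      by (rule finite_imageD) (simp add: inj_on_def)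
  qed auto
qed

section \<open>Test functions\<close>

lemma fun_supp_subset_closed:
  assumes "closed C" and "\<And>x. f x \<noteq> 0 \<Longrightarrow> x \<in> C"
  shows "fun_supp f \<subseteq> C"
  unfolding fun_supp_def using assms by (intro closure_minimal) auto

lemma in_fun_supp: "f x \<noteq> 0 \<Longrightarrow> x \<in> fun_supp f"
  unfolding fun_supp_def using closure_subset by fastforce

lemma closed_fun_supp: "closed (fun_supp f)"
  by (simp add: fun_supp_def)

text \<open>This spares the computation of closures. Closedness of \<open>C\<close> is a separate
  premise because compact sets may fail to be closed in a general topological space.\<close>

lemma CcI:
  assumes "continuous_on UNIV f" and "compact C" and "closed C" and "\<And>x. f x \<noteq> 0 \<Longrightarrow> x \<in> C"
  shows "f \<in> Cc"
proof -
  have "compact (C \<inter> fun_supp f)"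
    using assms(2) closed_fun_supp by (rule compact_Int_closed)
  moreover have "C \<inter> fun_supp f = fun_supp f"
    using fun_supp_subset_closed[of C f] assms(3,4) by blast
  ultimately show ?thesis
    using assms(1) by (simp add: Cc_def)
qed

lemma Cc_mult_left:
  fixes f g :: "'a::topological_space \<Rightarrow> complex"
  assumes "f \<in> Cc" and "continuous_on UNIV g"
  shows "(\<lambda>x. g x * f x) \<in> Cc"
proof (rule CcI[where C = "fun_supp f"])
  show "continuous_on UNIV (\<lambda>x. g x * f x)"
    using assms by (auto simp: Cc_def intro!: continuous_intros)
qed (use assms in \<open>auto simp: Cc_def closed_fun_supp intro: in_fun_supp\<close>)

lemma Cc_lincomb:
  fixes f g :: "'a::topological_space \<Rightarrow> complex"
  assumes "f \<in> Cc" and "g \<in> Cc"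
  shows "(\<lambda>x. a * f x + g x) \<in> Cc"
proof (rule CcI[where C = "fun_supp f \<union> fun_supp g"])
  show "continuous_on UNIV (\<lambda>x. a * f x + g x)"
    using assms by (auto simp: Cc_def intro!: continuous_intros)
  show "x \<in> fun_supp f \<union> fun_supp g" if "a * f x + g x \<noteq> 0" for x
    using that by (cases "f x = 0") (auto intro: in_fun_supp)
qed (use assms in \<open>auto simp: Cc_def closed_fun_supp\<close>)

lemma Cc_0: "(\<lambda>x. 0) \<in> Cc"
  by (auto simp: Cc_def fun_supp_def)

lemma Cc_sum:
  fixes h :: "'i \<Rightarrow> 'a::topological_space \<Rightarrow> complex"
  assumes "\<And>i. i \<in> I \<Longrightarrow> h i \<in> Cc"
  shows "(\<lambda>x. \<Sum>i\<in>I. h i x) \<in> Cc"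
  using assms
proof (induction I rule: infinite_finite_induct)
  case (insert i I)
  then show ?case
    using Cc_lincomb[of "h i" "\<lambda>x. \<Sum>i\<in>I. h i x" 1] by simp
qed (auto simp: Cc_0)

text \<open>The cutoff is \<open>max 0 (2 q - 1)\<close> for a Urysohn function \<open>q\<close>, which puts its support
  inside the closed set \<open>{q \<ge> 1/2}\<close>.\<close>

lemma Cc_cutoff:
  fixes x :: "'a::t2_space"
  assumes lc: "locally_compact_space (euclidean :: 'a topology)"
    and "open U" and "x \<in> U"
  obtains p :: "'a \<Rightarrow> real"
  where "continuous_on UNIV p" "\<And>y. 0 \<le> p y" "p x = 1" "p \<in> Cc" "fun_supp p \<subseteq> U"
proof -
  obtain V K where VK: "open V" "compact K" "x \<in> V" "V \<subseteq> K"
    using compact_neighbourhood[OF lc] by metis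
  have "Hausdorff_space (euclidean :: 'a topology)"
    unfolding Hausdorff_space_def disjnt_def open_openin[symmetric]
    by (intro allI impI) (elim conjE, rule hausdorff)
  then have "completely_regular_space (euclidean :: 'a topology)"
    using lc by (intro locally_compact_regular_imp_completely_regular_space) auto
  \<comment> \<open>Shrinking \<open>U\<close> to \<open>U \<inter> V\<close> traps the support in
    the compact set \<open>K\<close>.\<close>
  moreover have "closedin euclidean (- (U \<inter> V))" "x \<in> topspace euclidean - - (U \<inter> V)"
    using VK assms by auto
  ultimately obtain q where q: "continuous_map euclidean (top_of_set {0..1::real}) q"
      and q0: "q x = 0" and q1: "q ` (- (U \<inter> V)) \<subseteq> {1}"
    unfolding completely_regular_space_def by meson
  have cq: "continuous_on UNIV q"
    using q by (simp add: continuous_map_in_subtopology)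
  \<comment> \<open>Here \<open>q\<close> is \<open>0\<close> at \<open>x\<close> and
    \<open>1\<close> off \<open>U \<inter> V\<close>, so the Urysohn function that peaks at
    \<open>x\<close> is \<open>1 - q\<close>, and the support lies in
    \<open>{y. q y \<le> 1/2}\<close>.\<close>
  define p where "p y = max 0 (1 - 2 * q y)" for y
  have cp: "continuous_on UNIV p"
    unfolding p_def using cq by (intro continuous_intros)
  have cl: "closed {y. q y \<le> 1/2}"
    using cq by (intro closed_Collect_le continuous_intros)
  have sub: "{y. q y \<le> 1/2} \<subseteq> U \<inter> V"
  proof
    fix y assume "y \<in> {y. q y \<le> 1/2}"
    then have "q y \<noteq> 1"
      by simp
    then show "y \<in> U \<inter> V"
      using q1 by blast
  qed
  have pq: "q y \<le> 1/2" if "p y \<noteq> 0" for y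
    using that by (auto simp: p_def max_def split: if_splits)
  have "compact (K \<inter> {y. q y \<le> 1/2})"
    using VK(2) cl by (rule compact_Int_closed)
  moreover have "K \<inter> {y. q y \<le> 1/2} = {y. q y \<le> 1/2}"
    using sub VK(4) by auto
  ultimately have "p \<in> Cc"
    using cp cl pq by (intro CcI[where C = "{y. q y \<le> 1/2}"]) auto
  moreover have "fun_supp p \<subseteq> {y. q y \<le> 1/2}"
    using cl pq by (intro fun_supp_subset_closed) auto
  then have "fun_supp p \<subseteq> U"
    using sub by blast
  moreover have "0 \<le> p y" for y
    by (simp add: p_def)
  moreover have "p x = 1"
    by (simp add: p_def q0)
  ultimately show thesis
    using cp by (intro that[of p])
qed

section \<open>Radon measures and their supports\<close>

lemma radon_lincomb:
  assumes "radon_measure \<nu>" and "f \<in> Cc" and "g \<in> Cc"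
  shows "\<nu> (\<lambda>x. a * f x + g x) = a * \<nu> f + \<nu> g"
  using assms unfolding radon_measure_def by blast

lemma radon_0:
  assumes "radon_measure \<nu>"
  shows "\<nu> (\<lambda>x. 0) = 0"
  using radon_lincomb[OF assms Cc_0 Cc_0, of 1] by simp

lemma radon_sum:
  assumes "radon_measure \<nu>" and "\<And>i. i \<in> I \<Longrightarrow> h i \<in> Cc"
  shows "\<nu> (\<lambda>x. \<Sum>i\<in>I. a i * h i x) = (\<Sum>i\<in>I. a i * \<nu> (h i))"
  using assms(2)
proof (induction I rule: infinite_finite_induct)
  case (insert i I)
  have "(\<lambda>x. \<Sum>i\<in>I. a i * h i x) \<in> Cc"
    using insert.prems by (intro Cc_sum Cc_mult_left) auto
  with insert show ?case
    using radon_lincomb[OF assms(1), of "h i" "\<lambda>x. \<Sum>i\<in>I. a i * h i x" "a i"] by simp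
qed (auto simp: radon_0[OF assms(1)])

lemma measure_supp_test_function:
  assumes "x \<in> measure_supp \<nu>" and "open U" and "x \<in> U"
  obtains f where "f \<in> Cc" "fun_supp f \<subseteq> U" "\<nu> f \<noteq> 0"
proof -
  have "\<not> (open U \<and> (\<forall>f\<in>Cc. fun_supp f \<subseteq> U \<longrightarrow> \<nu> f = 0))"
    using assms(1,3) unfolding measure_supp_def by blast
  then obtain f where "f \<in> Cc" "fun_supp f \<subseteq> U" "\<nu> f \<noteq> 0"
    using assms(2) by metis
  then show thesis
    by (rule that)
qed

text \<open>A partition of unity cuts \<open>f\<close> into finitely many pieces, each supported in
  an open set on which \<open>\<nu>\<close> vanishes.\<close>

lemma radon_eq_0_if_supp_disjoint:
  fixes \<nu> :: "'a::t2_space functional"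
  assumes lc: "locally_compact_space (euclidean :: 'a topology)"
    and \<nu>: "radon_measure \<nu>" and f: "f \<in> Cc"
    and disj: "fun_supp f \<inter> measure_supp \<nu> = {}"
  shows "\<nu> f = 0"
proof -
  define good where
    "good p \<longleftrightarrow> continuous_on UNIV p \<and> (\<forall>y. 0 \<le> p y) \<and>
       (\<exists>U. open U \<and> (\<forall>h\<in>Cc. fun_supp h \<subseteq> U \<longrightarrow> \<nu> h = 0) \<and> fun_supp p \<subseteq> U)"
    for p :: "'a \<Rightarrow> real"
  have "\<exists>p. good p \<and> p x = 1" if "x \<in> fun_supp f" for x
  proof -
    have "x \<notin> measure_supp \<nu>"
      using disj that by blast
    then obtain U where U: "open U" "x \<in> U" "\<forall>h\<in>Cc. fun_supp h \<subseteq> U \<longrightarrow> \<nu> h = 0"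
      unfolding measure_supp_def by auto
    obtain p :: "'a \<Rightarrow> real" where p: "continuous_on UNIV p" "\<And>y. 0 \<le> p y" "p x = 1"
        "fun_supp p \<subseteq> U"
      using Cc_cutoff[OF lc U(1,2)] by metis
    have "good p"
      unfolding good_def by (intro conjI allI exI[of _ U] p U)
    with p(3) show ?thesis
      by blast
  qed
  then obtain p where p: "\<And>x. x \<in> fun_supp f \<Longrightarrow> good (p x) \<and> p x x = 1"
    by metis
  have cp: "continuous_on UNIV (p x)" and p0: "0 \<le> p x y" if "x \<in> fun_supp f" for x y
    using p[OF that] by (auto simp: good_def)
  have "open {y. 1/2 < p x y}" if "x \<in> fun_supp f" for x
    using cp[OF that] by (intro open_Collect_less continuous_intros)
  moreover have "compact (fun_supp f)"
    using f by (simp add: Cc_def)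
  moreover have "fun_supp f \<subseteq> (\<Union>x\<in>fun_supp f. {y. 1/2 < p x y})"
    using p by force
  ultimately obtain I where I: "I \<subseteq> fun_supp f" "finite I"
      and cover: "fun_supp f \<subseteq> (\<Union>x\<in>I. {y. 1/2 < p x y})"
    using compactE_image[of "fun_supp f" "fun_supp f" "\<lambda>x. {y. 1/2 < p x y}"] by metis
  \<comment> \<open>The lower bound \<open>1/2\<close> keeps the quotients continuous everywhere. On
    the support of \<open>f\<close> some \<open>p x\<close> exceeds \<open>1/2\<close>, so there
    \<open>P\<close> is the plain sum and the quotients add up to \<open>1\<close>.\<close>
  define P where "P y = max (1/2) (\<Sum>x\<in>I. p x y)" for y
  define h where "h x y = of_real (p x y / P y) * f y" for x y
  have Ppos: "P y > 0" for y
    by (simp add: P_def max_def)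
  have cP: "continuous_on UNIV P"
    unfolding P_def using cp I by (intro continuous_intros) auto
  have hCc: "h x \<in> Cc" if "x \<in> I" for x
  proof -
    have "continuous_on UNIV (\<lambda>y. complex_of_real (p x y / P y))"
      using cP cp I(1) that Ppos
      by (intro continuous_intros) (auto simp: less_imp_neq[THEN not_sym])
    then show ?thesis
      unfolding h_def using f by (rule Cc_mult_left[rotated])
  qed
  have h0: "\<nu> (h x) = 0" if "x \<in> I" for x
  proof -
    have "good (p x)"
      using p I(1) that by blast
    then obtain U where U: "\<forall>h\<in>Cc. fun_supp h \<subseteq> U \<longrightarrow> \<nu> h = 0" "fun_supp (p x) \<subseteq> U"
      unfolding good_def by metis
    have "fun_supp (h x) \<subseteq> fun_supp (p x)"
      by (rule fun_supp_subset_closed[OF closed_fun_supp]) (auto simp: h_def intro: in_fun_supp)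
    then show ?thesis
      using U hCc[OF that] by blast
  qed
  have "f y = (\<Sum>x\<in>I. 1 * h x y)" for y
  proof (cases "f y = 0")
    case False
    then obtain x where x: "x \<in> I" "1/2 < p x y"
      using cover in_fun_supp[of f y] by blast
    have "p x y \<le> (\<Sum>x\<in>I. p x y)"
      using I p0 x by (intro member_le_sum) auto
    then have "P y = (\<Sum>x\<in>I. p x y)"
      using x by (simp add: P_def)
    then have "(\<Sum>x\<in>I. p x y / P y) = 1"
      using Ppos[of y] by (simp flip: sum_divide_distrib)
    moreover have "(\<Sum>x\<in>I. 1 * h x y) = of_real (\<Sum>x\<in>I. p x y / P y) * f y"
      unfolding h_def by (simp only: mult_1 sum_distrib_right of_real_sum)
    ultimately show ?thesis
      by simp
  qed (simp add: h_def)
  then have "\<nu> f = \<nu> (\<lambda>y. \<Sum>x\<in>I. 1 * h x y)"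
    by presburger
  also have "\<dots> = (\<Sum>x\<in>I. 1 * \<nu> (h x))"
    by (rule radon_sum[OF \<nu> hCc])
  also have "\<dots> = 0"
    using h0 by simp
  finally show ?thesis .
qed

text \<open>Soft thresholding replaces \<open>h\<close> by a uniformly \<open>e\<close>-close function supported in
  \<open>{|h| \<ge> e}\<close>, away from the support of the measure.\<close>

lemma radon_eq_0_if_vanishes_on_supp:
  fixes \<nu> :: "'a::t2_space functional"
  assumes lc: "locally_compact_space (euclidean :: 'a topology)"
    and \<nu>: "radon_measure \<nu>" and h: "h \<in> Cc"
    and zero: "\<And>x. x \<in> measure_supp \<nu> \<Longrightarrow> h x = 0"
  shows "\<nu> h = 0"
proof -
  have ch: "continuous_on UNIV h"
    using h by (simp add: Cc_def)
  have "compact (fun_supp h)"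
    using h by (simp add: Cc_def)
  \<comment> \<open>One constant \<open>B\<close> serves every \<open>e\<close>, because all the
    errors below are supported in \<open>fun_supp h\<close>.\<close>
  then obtain B where "\<forall>f\<in>Cc. \<forall>b. fun_supp f \<subseteq> fun_supp h \<and> (\<forall>x. cmod (f x) \<le> b) \<longrightarrow>
      cmod (\<nu> f) \<le> B * b"
    using \<nu>[unfolded radon_measure_def, THEN conjunct2] by metis
  then have B: "\<And>f b. f \<in> Cc \<Longrightarrow> fun_supp f \<subseteq> fun_supp h \<Longrightarrow> (\<And>x. cmod (f x) \<le> b) \<Longrightarrow>
      cmod (\<nu> f) \<le> B * b"
    by simp
  have bound: "cmod (\<nu> h) \<le> B * e" if e: "e > 0" for e
  proof -
    \<comment> \<open>Multiplication by \<open>r\<close> lowers \<open>|h|\<close> by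
      \<open>e\<close>, or to \<open>0\<close> where \<open>|h|\<close> is at most \<open>e\<close>.
      The \<open>max\<close> in the denominator makes \<open>r\<close> continuous at the zeros of
      \<open>h\<close>.\<close>
    define r where "r x = max 0 (cmod (h x) - e) / max (cmod (h x)) e" for x
    have cr: "continuous_on UNIV r"
      unfolding r_def using ch e by (intro continuous_intros) (auto simp: max_def)
    let ?g = "\<lambda>x. complex_of_real (r x) * h x"
    have g: "?g \<in> Cc"
      using h cr by (intro Cc_mult_left continuous_intros)
    have cl: "closed {x. e \<le> cmod (h x)}"
      using ch by (intro closed_Collect_le continuous_intros)
    have "fun_supp ?g \<subseteq> {x. e \<le> cmod (h x)}"
      using cl by (rule fun_supp_subset_closed) (auto simp: r_def max_def split: if_splits)
    then have "fun_supp ?g \<inter> measure_supp \<nu> = {}"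
      using zero e by force
    then have "\<nu> ?g = 0"
      by (rule radon_eq_0_if_supp_disjoint[OF lc \<nu> g])
    then have eq: "\<nu> (\<lambda>x. (- 1) * ?g x + h x) = \<nu> h"
      using radon_lincomb[OF \<nu> g h, of "- 1"] by simp
    have "cmod (\<nu> (\<lambda>x. (- 1) * ?g x + h x)) \<le> B * e"
    proof (rule B)
      show "(\<lambda>x. (- 1) * ?g x + h x) \<in> Cc"
        using g h by (rule Cc_lincomb)
      show "fun_supp (\<lambda>x. (- 1) * ?g x + h x) \<subseteq> fun_supp h"
        by (rule fun_supp_subset_closed[OF closed_fun_supp]) (auto intro!: in_fun_supp)
      show "cmod ((- 1) * ?g x + h x) \<le> e" for x
      proof -
        have "(- 1) * ?g x + h x = of_real (1 - r x) * h x"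
          by (simp add: algebra_simps)
        then have "cmod ((- 1) * ?g x + h x) = \<bar>1 - r x\<bar> * cmod (h x)"
          by (simp only: norm_mult norm_of_real)
        also have "\<dots> \<le> e"
        proof (cases "cmod (h x) \<le> e")
          case True
          then show ?thesis
            by (simp add: r_def)
        next
          case False
          moreover from this have "cmod (h x) > 0"
            using e by linarith
          ultimately have "1 - r x = e / cmod (h x)"
            by (simp add: r_def max_def diff_divide_distrib)
          then show ?thesis
            using False e by auto
        qed
        finally show ?thesis .
      qed
    qed
    then show ?thesis
      by (simp only: eq)
  qed
  have "B \<ge> 0"
    using order_trans[OF norm_ge_zero bound[of 1]] by simp
  have "cmod (\<nu> h) \<le> 0 + d" if "d > 0" for d
  proof -
    \<comment> \<open>Dividing by \<open>B + 1\<close> covers the case \<open>B = 0\<close>.\<close>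
    have "cmod (\<nu> h) \<le> B * (d / (B + 1))"
      using that \<open>B \<ge> 0\<close> by (intro bound) simp
    also have "\<dots> \<le> d"
      using that \<open>B \<ge> 0\<close> by (simp add: field_simps)
    finally show ?thesis
      by simp
  qed
  then have "cmod (\<nu> h) \<le> 0"
    by (rule field_le_epsilon)
  then show ?thesis
    by simp
qed

text \<open>A test function is nonzero at only finitely many points of the support. It therefore
  agrees on the support with a finite combination of functions \<open>p x\<close> that are
  \<open>1\<close> at \<open>x\<close> and vanish on the rest of the support.\<close>

lemma pure_point_if_locally_finite_supp:
  fixes \<nu> :: "'a::t2_space functional"
  assumes lc: "locally_compact_space (euclidean :: 'a topology)"
    and \<nu>: "radon_measure \<nu>" and lf: "locally_finite (measure_supp \<nu>)"
  shows "pure_point \<nu>"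
proof -
  let ?S = "measure_supp \<nu>"
  have "\<exists>p::'a \<Rightarrow> complex. p \<in> Cc \<and> p x = 1 \<and> (\<forall>y\<in>?S - {x}. p y = 0)" for x
  proof -
    have "locally_finite (?S - {x})"
      using lf by (rule locally_finite_subset) auto
    then have "open (- (?S - {x}))"
      using locally_finite_imp_closed[OF lc] by blast
    moreover have "x \<in> - (?S - {x})"
      by simp
    ultimately obtain p :: "'a \<Rightarrow> real" where p: "continuous_on UNIV p" "p x = 1" "p \<in> Cc"
        "fun_supp p \<subseteq> - (?S - {x})"
      using Cc_cutoff[OF lc, where U = "- (?S - {x})" and x = x] by metis
    have "(\<lambda>y. complex_of_real (p y)) \<in> Cc"
      using p by (intro CcI[where C = "fun_supp p"])
        (auto simp: Cc_def closed_fun_supp intro: in_fun_supp continuous_intros)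
    moreover have "p y = 0" if "y \<in> ?S - {x}" for y
      using p(4) that in_fun_supp[of p y] by blast
    ultimately show ?thesis
      using p(2) by (intro exI[of _ "\<lambda>y. complex_of_real (p y)"]) auto
  qed
  then obtain p :: "'a \<Rightarrow> 'a \<Rightarrow> complex"
    where p: "\<And>x. p x \<in> Cc" "\<And>x. p x x = 1" "\<And>x y. y \<in> ?S \<Longrightarrow> y \<noteq> x \<Longrightarrow> p x y = 0"
    by (metis DiffI singletonD)
  \<comment> \<open>With weight \<open>0\<close> off the support, only the finitely many indices in
    \<open>I\<close> contribute for a given \<open>f\<close>.\<close>
  define w where "w x = (if x \<in> ?S then \<nu> (p x) else 0)" for x
  have "((\<lambda>x. w x * dirac x f) has_sum \<nu> f) UNIV" if f: "f \<in> Cc" for f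
  proof -
    define I where "I = ?S \<inter> fun_supp f"
    have I: "finite I"
      using lf f by (simp add: I_def locally_finite_def Cc_def)
    let ?g = "\<lambda>y. \<Sum>x\<in>I. f x * p x y"
    have g: "?g \<in> Cc"
      using p(1) by (intro Cc_sum Cc_mult_left) auto
    have "\<nu> (\<lambda>y. (- 1) * ?g y + f y) = 0"
    proof (rule radon_eq_0_if_vanishes_on_supp[OF lc \<nu>])
      show "(\<lambda>y. (- 1) * ?g y + f y) \<in> Cc"
        using g f by (rule Cc_lincomb)
      fix y assume y: "y \<in> ?S"
      \<comment> \<open>Terms with \<open>x \<noteq> y\<close> vanish since \<open>y\<close> is in
        the support; if \<open>y\<close> is not in \<open>I\<close>, then
        \<open>f y = 0\<close>.\<close>
      have "?g y = (\<Sum>x\<in>I. if x = y then f y else 0)"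
        using p y by (intro sum.cong) auto
      also have "\<dots> = f y"
        using I y in_fun_supp[of f y] by (auto simp: I_def)
      finally show "(- 1) * ?g y + f y = 0"
        by simp
    qed
    then have "\<nu> f = \<nu> ?g"
      using radon_lincomb[OF \<nu> g f, of "- 1"] by simp
    also have "\<dots> = (\<Sum>x\<in>I. f x * \<nu> (p x))"
      using \<nu> p(1) by (rule radon_sum)
    also have "\<dots> = (\<Sum>x\<in>I. w x * dirac x f)"
      by (intro sum.cong) (auto simp: w_def I_def dirac_def)
    finally have "((\<lambda>x. w x * dirac x f) has_sum \<nu> f) I"
      using I by (simp add: has_sum_finite)
    moreover have "w x * dirac x f = 0" if "x \<notin> I" for x
      using that in_fun_supp[of f x] by (auto simp: w_def I_def dirac_def)
    ultimately show ?thesis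
      by (subst has_sum_cong_neutral[where T = I and g = "\<lambda>x. w x * dirac x f"]) auto
  qed
  then show ?thesis
    unfolding pure_point_def by blast
qed

text \<open>Serves to obtain \<open>\<mu>\<^sub>0\<close> as the difference of \<open>\<mu>\<close>
  and \<open>\<mu>\<^sub>s\<close>, without a study of its support.\<close>

lemma pure_point_diff:
  assumes "pure_point \<mu>" and "pure_point \<nu>" and "\<And>f. f \<in> Cc \<Longrightarrow> \<rho> f = \<mu> f - \<nu> f"
  shows "pure_point \<rho>"
proof -
  obtain v w where "\<forall>f\<in>Cc. ((\<lambda>x. v x * dirac x f) has_sum \<mu> f) UNIV"
      and "\<forall>f\<in>Cc. ((\<lambda>x. w x * dirac x f) has_sum \<nu> f) UNIV"
    using assms(1,2) unfolding pure_point_def by auto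
  then have "((\<lambda>x. v x * dirac x f + - (w x * dirac x f)) has_sum (\<mu> f + - \<nu> f)) UNIV"
    if "f \<in> Cc" for f
    using that by (intro has_sum_add has_sum_uminusI) auto
  then have "\<forall>f\<in>Cc. ((\<lambda>x. (v x - w x) * dirac x f) has_sum \<rho> f) UNIV"
    using assms(3) by (simp add: left_diff_distrib)
  then show ?thesis
    unfolding pure_point_def by (intro exI[of _ "\<lambda>x. v x - w x"])
qed

section \<open>Means and Bohr almost periodic functions\<close>

lemma haar_measureD:
  assumes "haar_measure \<theta>"
  shows "sets \<theta> = sets borel"
    and "compact K \<Longrightarrow> emeasure \<theta> K < \<infinity>"
    and "B \<in> sets borel \<Longrightarrow> emeasure \<theta> ((+) x ` B) = emeasure \<theta> B"
  using assms[unfolded haar_measure_def] by (elim conjE, simp only:)+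

text \<open>By invariance, \<open>\<theta>\<close> is its own image under translation by
  \<open>x\<close>; the rest is the change of variables for image measures.\<close>

lemma haar_set_integral_translate:
  fixes \<theta> :: "'a::{topological_ab_group_add, t2_space} measure" and h :: "'a \<Rightarrow> real"
  assumes "haar_measure \<theta>" and "compact A" and "continuous_on UNIV h"
  shows "(LINT t:((+) x ` A)|\<theta>. h t) = (LINT t:A|\<theta>. h (x + t))"
proof -
  have sets: "sets \<theta> = sets borel"
    using assms(1) by (rule haar_measureD)
  have m: "(+) x \<in> measurable \<theta> borel"
    unfolding measurable_cong_sets[OF sets refl]
    by (intro borel_measurable_continuous_onI continuous_intros)
  have "distr \<theta> borel ((+) x) = \<theta>"
  proof (rule measure_eqI)
    fix B assume "B \<in> sets (distr \<theta> borel ((+) x))"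
    then have B: "B \<in> sets borel"
      by simp
    have "space \<theta> = UNIV"
      using sets_eq_imp_space_eq[OF sets] by simp
    moreover have "z \<in> (+) (- x) ` B" if "x + z \<in> B" for z
      using that by (rule rev_image_eqI) simp
    ultimately have vim: "(+) x -` B \<inter> space \<theta> = (+) (- x) ` B"
      by auto
    have "emeasure \<theta> ((+) (- x) ` B) = emeasure \<theta> B"
      using assms(1) B by (rule haar_measureD)
    then show "emeasure (distr \<theta> borel ((+) x)) B = emeasure \<theta> B"
      using B m by (simp only: emeasure_distr vim)
  qed (simp add: sets)
  then have "(LINT t:((+) x ` A)|\<theta>. h t) = (LINT t:((+) x ` A)|distr \<theta> borel ((+) x). h t)"
    by simp
  also have "\<dots> = (LINT t|\<theta>. indicator ((+) x ` A) (x + t) *\<^sub>R h (x + t))"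
    unfolding set_lebesgue_integral_def
  proof (rule integral_distr[OF m])
    have "compact ((+) x ` A)"
      using assms(2) by (intro compact_continuous_image continuous_intros)
    then have "(+) x ` A \<in> sets borel"
      by (intro borel_closed compact_imp_closed)
    then show "(\<lambda>t. indicator ((+) x ` A) t *\<^sub>R h t) \<in> borel_measurable borel"
      using borel_measurable_continuous_onI[OF assms(3)] by measurable
  qed
  also have "\<dots> = (LINT t:A|\<theta>. h (x + t))"
    unfolding set_lebesgue_integral_def
    by (intro Bochner_Integration.integral_cong) (auto simp: indicator_def)
  finally show ?thesis .
qed

text \<open>The mean is uniform in translations, so it may be read off at the single translate by
  \<open>x\<close>; invariance of Haar measure then moves \<open>x\<close> from the Foelner set into
  the integrand.\<close>

lemma null_mean_translate:
  fixes \<theta> :: "'a::{topological_ab_group_add, t2_space} measure"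
  assumes \<theta>: "haar_measure \<theta>" and A: "folner \<theta> A"
    and f: "null_weak_ap \<theta> f"
  shows "(\<lambda>n. (LINT t:A n|\<theta>. cmod (f (x + t))) / measure \<theta> (A n)) \<longlonglongrightarrow> 0"
proof -
  have "uniform_limit UNIV (\<lambda>n x. (LINT t:((+) x ` A n)|\<theta>. complex_of_real (cmod (f t))) /
      of_real (measure \<theta> (A n))) (\<lambda>_. 0) sequentially"
    using f A unfolding null_weak_ap_def has_mean_def by blast
  from tendsto_uniform_limitI[OF this UNIV_I[of x]]
  have "(\<lambda>n. (LINT t:((+) x ` A n)|\<theta>. complex_of_real (cmod (f t))) /
      of_real (measure \<theta> (A n))) \<longlonglongrightarrow> 0" .
  moreover have "(LINT t:((+) x ` A n)|\<theta>. complex_of_real (cmod (f t))) /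
      of_real (measure \<theta> (A n)) = of_real ((LINT t:A n|\<theta>. cmod (f (x + t))) / measure \<theta> (A n))"
    for n
  proof -
    have "compact (A n)"
      using A unfolding folner_def by blast
    moreover have "continuous_on UNIV (\<lambda>t. cmod (f t))"
      by (intro continuous_on_norm continuous_on_apply_bcontfun)
    ultimately show ?thesis
      using haar_set_integral_translate[OF \<theta>, of "A n" "\<lambda>t. cmod (f t)" x]
      by (simp add: set_integral_complex_of_real)
  qed
  ultimately show ?thesis
    using tendsto_of_real_iff[where 'a = complex] by fastforce
qed

text \<open>Compactness in the subspace \<open>Cu\<close> is compactness in the whole space of
  bounded continuous functions, where the later metric arguments take place.\<close>

lemma bohr_ap_orbit:
  assumes "bohr_ap F"
  obtains C where "compact C" "range (\<lambda>t. translate t F) \<subseteq> C"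
proof -
  let ?C = "(top_of_set Cu) closure_of (range (\<lambda>t. translate t F))"
  have "range (\<lambda>t. translate t F) \<subseteq> topspace (top_of_set Cu)" "compactin (top_of_set Cu) ?C"
    using assms by (auto simp: bohr_ap_def precompact_in_def Cu_norm_topology_def)
  then show thesis
    using that[of ?C] closure_of_subset[of "range (\<lambda>t. translate t F)" "top_of_set Cu"]
    by (simp add: compactin_subtopology)
qed

text \<open>The same index must serve \<open>F\<close> and \<open>G\<close>. So the net is taken in
  the orbit of pairs, whose closure is a closed subset of a product of two compact sets.\<close>

lemma bohr_ap_joint_net:
  assumes F: "bohr_ap F" and G: "bohr_ap G" and "e > 0"
  obtains I where "finite I"
    "\<And>t. \<exists>i\<in>I. dist (translate i F, translate i G) (translate t F, translate t G) < e"
proof -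
  obtain C D where C: "compact C" "range (\<lambda>t. translate t F) \<subseteq> C"
      and D: "compact D" "range (\<lambda>t. translate t G) \<subseteq> D"
    using bohr_ap_orbit F G by metis
  define q where "q t = (translate t F, translate t G)" for t
  have "closure (range q) \<subseteq> C \<times> D"
    using C D by (intro closure_minimal closed_Times compact_imp_closed) (auto simp: q_def)
  then have "compact ((C \<times> D) \<inter> closure (range q))" "(C \<times> D) \<inter> closure (range q) = closure (range q)"
    using C D by (auto intro: compact_Int_closed compact_Times)
  then have "compact (closure (range q))"
    by simp
  moreover have "closure (range q) \<subseteq> (\<Union>t\<in>UNIV. ball (q t) e)"
    using \<open>e > 0\<close> by (fastforce simp: closure_approachable)
  ultimately obtain I where I: "finite I" "closure (range q) \<subseteq> (\<Union>t\<in>I. ball (q t) e)"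
    using compactE_image[of "closure (range q)" UNIV "\<lambda>t. ball (q t) e"] by auto
  have "\<exists>i\<in>I. dist (q i) (q t) < e" for t
    using I(2) closure_subset[of "range q"] by fastforce
  then show thesis
    using I(1) by (intro that[of I]) (auto simp: q_def)
qed

text \<open>If \<open>F x G x \<noteq> 0\<close>, then by almost periodicity finitely many translates of \<open>|F G|\<close> have a sum
  bounded below by a positive constant, whereas each translate has mean zero.\<close>

lemma bohr_ap_product_eq_0:
  fixes \<theta> :: "'a::{topological_ab_group_add, t2_space} measure"
  assumes \<theta>: "haar_measure \<theta>" and A: "folner \<theta> A"
    and F: "bohr_ap F" and G: "bohr_ap G"
    and F0: "null_weak_ap \<theta> F0" and G0: "null_weak_ap \<theta> G0"
    and prod: "\<And>t. (F t + F0 t) * (G t + G0 t) = 0"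
  shows "F x * G x = 0"
proof (rule ccontr)
  assume nz: "F x * G x \<noteq> 0"
  \<comment> \<open>Halving leaves room for perturbation: by continuity of the product, values
    within \<open>e\<close> of \<open>(F x, G x)\<close> still have a product of modulus above
    \<open>d\<close>.\<close>
  define d where "d = cmod (F x * G x) / 2"
  have d: "d > 0"
    using nz by (simp add: d_def)
  have "open {z :: complex \<times> complex. d < cmod (fst z * snd z)}"
    by (intro open_Collect_less continuous_intros)
  moreover have "(F x, G x) \<in> {z. d < cmod (fst z * snd z)}"
    using nz by (simp add: d_def)
  ultimately obtain e where e: "e > 0"
      "\<And>z. dist z (F x, G x) < e \<Longrightarrow> d < cmod (fst z * snd z)"
    unfolding open_dist by blast
  obtain I where I: "finite I"
      and net: "\<And>t. \<exists>i\<in>I. dist (translate i F, translate i G) (translate t F, translate t G) < e"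
    using bohr_ap_joint_net[OF F G e(1)] by blast
  define C where "C = norm F + norm G + norm G0"
  define k where "k t = cmod (F0 t) + cmod (G0 t)" for t
  have k: "cmod (F t * G t) \<le> C * k t" for t
  proof -
    \<comment> \<open>Expanding \<open>prod\<close> leaves only terms with a factor
      \<open>F0\<close> or \<open>G0\<close>; the cofactors are bounded by \<open>C\<close>.\<close>
    have "F t * G t = - (F t * G0 t) - F0 t * (G t + G0 t)"
      using prod[of t] by (simp add: algebra_simps eq_neg_iff_add_eq_0)
    then have "cmod (F t * G t) \<le> cmod (F t * G0 t) + cmod (F0 t * (G t + G0 t))"
      by (metis norm_minus_cancel norm_triangle_ineq4)
    also have "\<dots> \<le> norm F * cmod (G0 t) + cmod (F0 t) * (norm G + norm G0)"
      unfolding norm_mult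
      by (intro add_mono mult_mono norm_bounded order_trans[OF norm_triangle_ineq]) auto
    also have "\<dots> \<le> C * k t"
      by (simp add: C_def k_def algebra_simps)
    finally show ?thesis .
  qed
  have lower: "d \<le> (\<Sum>i\<in>I. C * k (x + i + s))" for s
  proof -
    obtain i where i: "i \<in> I"
        "dist (translate i F, translate i G) (translate (- s) F, translate (- s) G) < e"
      using net by blast
    \<comment> \<open>At the point \<open>x + i\<close>, the translate by \<open>- s\<close> takes
      the value at \<open>x + i + s\<close> and the translate by \<open>i\<close> the value at
      \<open>x\<close>. Closeness in sup norm thus compares these two values.\<close>
    have "dist (translate (- s) F (x + i), translate (- s) G (x + i))
        (translate i F (x + i), translate i G (x + i))
        \<le> dist (translate (- s) F, translate (- s) G) (translate i F, translate i G)"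
      unfolding dist_Pair_Pair by (intro real_sqrt_le_mono add_mono power_mono dist_bounded) auto
    then have "dist (F (x + i + s), G (x + i + s)) (F x, G x) < e"
      using i(2) by (simp add: translate_apply dist_commute)
    then have "d < cmod (F (x + i + s) * G (x + i + s))"
      using e(2) by force
    also have "\<dots> \<le> C * k (x + i + s)"
      by (rule k)
    also have "\<dots> \<le> (\<Sum>i\<in>I. C * k (x + i + s))"
      using i(1) I by (intro member_le_sum) (auto simp: C_def k_def)
    finally show ?thesis
      by simp
  qed
  \<comment> \<open>The average of \<open>C * k (x + i + t)\<close> over \<open>t\<close> in
    \<open>A n\<close>, written so that both summands are visibly null means.\<close>
  define a where "a i n = C * ((LINT t:A n|\<theta>. cmod (F0 (x + i + t))) / measure \<theta> (A n) +
      (LINT t:A n|\<theta>. cmod (G0 (x + i + t))) / measure \<theta> (A n))" for i n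
  have "(\<lambda>n. \<Sum>i\<in>I. a i n) \<longlonglongrightarrow> (\<Sum>i\<in>I. C * (0 + 0))"
    unfolding a_def by (intro tendsto_intros null_mean_translate[OF \<theta> A] F0 G0)
  moreover have "d \<le> (\<Sum>i\<in>I. a i n)" for n
  proof -
    have cA: "compact (A n)" and pos: "0 < measure \<theta> (A n)"
      using A unfolding folner_def by blast+
    have sets: "sets \<theta> = sets borel"
      using \<theta> by (rule haar_measureD)
    have mA: "A n \<in> sets \<theta>"
      unfolding sets using cA by (intro borel_closed compact_imp_closed)
    have fA: "emeasure \<theta> (A n) < \<infinity>"
      using \<theta> cA by (rule haar_measureD)
    have int: "set_integrable \<theta> (A n) (\<lambda>t. cmod (H (y + t)))" for H :: "'a \<Rightarrow>\<^sub>C complex" and y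
      unfolding set_integrable_def
    proof (rule integrableI_bounded_set_indicator[OF mA _ fA])
      show "(\<lambda>t. cmod (H (y + t))) \<in> borel_measurable \<theta>"
        unfolding measurable_cong_sets[OF sets refl]
        by (intro borel_measurable_continuous_onI continuous_on_norm
            continuous_on_compose2[OF continuous_on_apply_bcontfun[of UNIV]] continuous_intros) auto
      show "AE t in \<theta>. t \<in> A n \<longrightarrow> norm (cmod (H (y + t))) \<le> norm H"
        by (auto intro: norm_bounded)
    qed
    have intk: "set_integrable \<theta> (A n) (\<lambda>t. C * k (y + t))" for y
      unfolding k_def using int by (intro set_integrable_mult_right set_integral_add) auto
    have ik: "(LINT t:A n|\<theta>. C * k (x + i + t)) = a i n * measure \<theta> (A n)" for i
    proof -
      have "(LINT t:A n|\<theta>. C * k (x + i + t)) =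
          C * ((LINT t:A n|\<theta>. cmod (F0 (x + i + t))) + (LINT t:A n|\<theta>. cmod (G0 (x + i + t))))"
        unfolding k_def by (simp only: set_integral_mult_right set_integral_add(2)[OF int int])
      then show ?thesis
        using pos by (simp add: a_def flip: add_divide_distrib)
    qed
    \<comment> \<open>Integrating \<open>lower\<close> over \<open>A n\<close> and dividing by its
      positive measure gives a bound by \<open>d\<close> that is independent of
      \<open>n\<close>.\<close>
    have "d * measure \<theta> (A n) = (LINT t:A n|\<theta>. d)"
      using mA fA by (simp add: set_lebesgue_integral_def)
    also have "\<dots> \<le> (LINT t:A n|\<theta>. (\<Sum>i\<in>I. C * k (x + i + t)))"
    proof (rule set_integral_mono[OF _ _ lower])
      show "set_integrable \<theta> (A n) (\<lambda>t. d)"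
        using mA fA by (simp add: set_integrable_def)
      show "set_integrable \<theta> (A n) (\<lambda>t. \<Sum>i\<in>I. C * k (x + i + t))"
        using intk unfolding set_integrable_def scaleR_sum_right
        by (intro Bochner_Integration.integrable_sum)
    qed
    also have "\<dots> = (\<Sum>i\<in>I. LINT t:A n|\<theta>. C * k (x + i + t))"
      using intk unfolding set_lebesgue_integral_def set_integrable_def scaleR_sum_right
      by (intro Bochner_Integration.integral_sum)
    also have "\<dots> = (\<Sum>i\<in>I. a i n) * measure \<theta> (A n)"
      by (simp only: ik sum_distrib_right)
    finally show ?thesis
      using pos by simp
  qed
  ultimately have "d \<le> (\<Sum>i\<in>I. C * (0 + 0))"
    by (intro LIMSEQ_le_const) auto
  then show False
    using d by simp
qed

section \<open>Supports in sets with finite local complexity\<close>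

lemma Cc_reflect:
  fixes f :: "'a::{topological_ab_group_add, t2_space} \<Rightarrow> complex"
  assumes "f \<in> Cc"
  shows "(\<lambda>z. f (- z)) \<in> Cc"
proof (rule CcI[where C = "uminus ` fun_supp f"])
  show "continuous_on UNIV (\<lambda>z. f (- z))"
    using assms by (auto simp: Cc_def intro!: continuous_on_compose2[of UNIV f] continuous_intros)
  show comp: "compact (uminus ` fun_supp f)"
    using assms by (auto simp: Cc_def intro!: compact_continuous_image continuous_intros)
  then show "closed (uminus ` fun_supp f)"
    by (rule compact_imp_closed)
  show "z \<in> uminus ` fun_supp f" if "f (- z) \<noteq> 0" for z
    using in_fun_supp[of f, OF that] by (intro image_eqI[of _ _ "- z"]) auto
qed

lemma Cc_translate:
  fixes f :: "'a::{topological_ab_group_add, t2_space} \<Rightarrow> complex"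
  assumes "f \<in> Cc"
  shows "(\<lambda>t. f (t - s)) \<in> Cc"
proof (rule CcI[where C = "(+) s ` fun_supp f"])
  show "continuous_on UNIV (\<lambda>t. f (t - s))"
    using assms by (auto simp: Cc_def intro!: continuous_on_compose2[of UNIV f] continuous_intros)
  show comp: "compact ((+) s ` fun_supp f)"
    using assms by (auto simp: Cc_def intro!: compact_continuous_image continuous_intros)
  then show "closed ((+) s ` fun_supp f)"
    by (rule compact_imp_closed)
  show "t \<in> (+) s ` fun_supp f" if "f (t - s) \<noteq> 0" for t
    using in_fun_supp[of f, OF that] by (intro image_eqI[of _ _ "t - s"]) auto
qed

text \<open>Otherwise the translate of \<open>f\<close> would vanish on the whole support, and
  \<open>\<mu>\<close> would send it to \<open>0\<close>.\<close>

lemma radon_translate_supp: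
  fixes \<mu> :: "'a::{topological_ab_group_add, t2_space} functional"
  assumes "locally_compact_space (euclidean :: 'a topology)"
    and "radon_measure \<mu>" and "f \<in> Cc" and "fun_supp f \<subseteq> U"
    and "\<mu> (\<lambda>t. f (t - s)) \<noteq> 0"
  obtains a where "a \<in> measure_supp \<mu>" "a - s \<in> U"
proof -
  obtain a where a: "a \<in> measure_supp \<mu>" "f (a - s) \<noteq> 0"
    using radon_eq_0_if_vanishes_on_supp[OF assms(1,2) Cc_translate[OF assms(3)]] assms(5)
    by metis
  moreover have "a - s \<in> U"
    using in_fun_supp[of f, OF a(2)] assms(4) by blast
  ultimately show thesis
    by (intro that[of a])
qed

lemma SAP_part_supp_differences:
  fixes \<theta> :: "'a::{topological_ab_group_add, t2_space} measure"
  assumes lc: "locally_compact_space (euclidean :: 'a topology)"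
    and \<theta>: "haar_measure \<theta>" and A: "folner \<theta> A"
    and \<mu>: "radon_measure \<mu>"
    and cl: "closed {x - y | x y. x \<in> measure_supp \<mu> \<and> y \<in> measure_supp \<mu>}" (is "closed ?D")
    and dec: "eberlein_decomposition \<theta> \<mu> \<mu>\<^sub>s \<mu>\<^sub>0"
    and x: "x \<in> measure_supp \<mu>\<^sub>s" and y: "y \<in> measure_supp \<mu>\<^sub>s"
  shows "x - y \<in> {x - y | x y. x \<in> measure_supp \<mu> \<and> y \<in> measure_supp \<mu>}"
proof (rule ccontr)
  assume xy: "x - y \<notin> ?D"
  \<comment> \<open>Closedness of \<open>?D\<close> is what provides a box
    \<open>U \<times> V\<close> around \<open>(x, y)\<close> whose differences all avoid
    \<open>?D\<close>.\<close>
  have "open ((\<lambda>z. fst z - snd z) -` (- ?D) :: ('a \<times> 'a) set)"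
    using cl by (intro open_vimage continuous_intros) auto
  moreover have "(x, y) \<in> (\<lambda>z. fst z - snd z) -` (- ?D)"
    using xy by simp
  ultimately obtain U V where UV: "open U" "open V" "x \<in> U" "y \<in> V"
      "U \<times> V \<subseteq> (\<lambda>z. fst z - snd z) -` (- ?D)"
    by (elim open_prod_elim) auto
  obtain f where f: "f \<in> Cc" "fun_supp f \<subseteq> U" "\<mu>\<^sub>s f \<noteq> 0"
    using measure_supp_test_function[OF x UV(1,3)] by blast
  obtain g where g: "g \<in> Cc" "fun_supp g \<subseteq> V" "\<mu>\<^sub>s g \<noteq> 0"
    using measure_supp_test_function[OF y UV(2,4)] by blast
  \<comment> \<open>Reflecting \<open>h\<close> cancels the reflection built into
    \<open>convolve\<close>, so the almost periodicity conditions apply directly to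
    \<open>\<nu>\<close> evaluated on translates of \<open>h\<close>.\<close>
  have conv: "convolve (\<lambda>z. h (- z)) \<nu> = (\<lambda>s. \<nu> (\<lambda>t. h (t - s)))" for h :: "'a \<Rightarrow> complex" and \<nu>
    by (simp add: convolve_def fun_eq_iff)
  have "\<exists>H. apply_bcontfun H = (\<lambda>s. \<mu>\<^sub>s (\<lambda>t. h (t - s))) \<and> bohr_ap H" if "h \<in> Cc" for h
    using dec Cc_reflect[OF that] unfolding eberlein_decomposition_def SAP_def conv[symmetric]
    by blast
  then obtain F G :: "'a \<Rightarrow>\<^sub>C complex" where F: "\<And>s. F s = \<mu>\<^sub>s (\<lambda>t. f (t - s))" "bohr_ap F"
      and G: "\<And>s. G s = \<mu>\<^sub>s (\<lambda>t. g (t - s))" "bohr_ap G"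
    using f(1) g(1) by metis
  have "\<exists>H. apply_bcontfun H = (\<lambda>s. \<mu>\<^sub>0 (\<lambda>t. h (t - s))) \<and> null_weak_ap \<theta> H" if "h \<in> Cc" for h
    using dec Cc_reflect[OF that] unfolding eberlein_decomposition_def WAP0_def conv[symmetric]
    by blast
  then obtain F0 G0 :: "'a \<Rightarrow>\<^sub>C complex" where F0: "\<And>s. F0 s = \<mu>\<^sub>0 (\<lambda>t. f (t - s))" "null_weak_ap \<theta> F0"
      and G0: "\<And>s. G0 s = \<mu>\<^sub>0 (\<lambda>t. g (t - s))" "null_weak_ap \<theta> G0"
    using f(1) g(1) by metis
  have sum: "\<mu>\<^sub>s (\<lambda>t. h (t - s)) + \<mu>\<^sub>0 (\<lambda>t. h (t - s)) = \<mu> (\<lambda>t. h (t - s))" if "h \<in> Cc" for h s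
    using dec Cc_translate[OF that] by (simp add: eberlein_decomposition_def equal_measures_def)
  have "(F s + F0 s) * (G s + G0 s) = 0" for s
  proof (rule ccontr)
    assume "(F s + F0 s) * (G s + G0 s) \<noteq> 0"
    then have "\<mu> (\<lambda>t. f (t - s)) \<noteq> 0" "\<mu> (\<lambda>t. g (t - s)) \<noteq> 0"
      by (auto simp: F G F0 G0 sum f(1) g(1))
    \<comment> \<open>The common shift \<open>s\<close> cancels in the difference, so
      \<open>a - b\<close> is a difference of support points that avoids \<open>?D\<close>, which is
      absurd.\<close>
    then obtain a b where ab: "a \<in> measure_supp \<mu>" "a - s \<in> U" "b \<in> measure_supp \<mu>" "b - s \<in> V"
      using radon_translate_supp[OF lc \<mu>] f g by metis
    then have "(a - s, b - s) \<in> (\<lambda>z. fst z - snd z) -` (- ?D)"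
      using UV(5) by blast
    then have "(a - s) - (b - s) \<notin> ?D"
      by (simp only: vimage_eq fst_conv snd_conv Compl_iff not_False_eq_True)
    moreover have "(a - s) - (b - s) = a - b"
      by simp
    ultimately show False
      using ab by auto
  qed
  then have "F 0 * G 0 = 0"
    using bohr_ap_product_eq_0[OF \<theta> A] F G F0 G0 by blast
  then show False
    using f(3) g(3) by (simp add: F G)
qed

theorem theorem6p8:
  fixes \<theta> :: "'a::{topological_ab_group_add, t2_space} measure"
    and \<mu> \<mu>\<^sub>s \<mu>\<^sub>0 :: "'a functional"
    and \<Lambda> :: "'a set"
  assumes "locally_compact_space (euclidean :: 'a topology)"
    and "haar_measure \<theta>"
    and "\<exists>A. folner \<theta> A"
    and "\<mu> \<in> WAP"
    and "FLC \<Lambda>" and "measure_supp \<mu> \<subseteq> \<Lambda>"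
    and "eberlein_decomposition \<theta> \<mu> \<mu>\<^sub>s \<mu>\<^sub>0"
  shows "pure_point \<mu>\<^sub>s \<and> pure_point \<mu>\<^sub>0 \<and> FLC (measure_supp \<mu>\<^sub>s)"
proof -
  obtain A where A: "folner \<theta> A"
    using assms(3) by blast
  have \<mu>: "radon_measure \<mu>"
    using assms(4) by (simp add: WAP_def)
  have \<mu>s: "radon_measure \<mu>\<^sub>s" and sum: "\<And>f. f \<in> Cc \<Longrightarrow> \<mu> f = \<mu>\<^sub>s f + \<mu>\<^sub>0 f"
    using assms(7) by (auto simp: eberlein_decomposition_def SAP_def equal_measures_def)
  \<comment> \<open>Differences of the support itself replace those of \<open>\<Lambda>\<close>;
    local finiteness of \<open>?D\<close> then also shows that \<open>\<mu>\<close> is pure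
    point.\<close>
  let ?D = "{x - y | x y. x \<in> measure_supp \<mu> \<and> y \<in> measure_supp \<mu>}"
  have "locally_finite {x - y | x y. x \<in> \<Lambda> \<and> y \<in> \<Lambda>}"
    using assms(5) by (simp add: FLC_def)
  then have D: "locally_finite ?D"
    by (rule locally_finite_subset) (use assms(6) in blast)
  then have "closed ?D"
    by (rule locally_finite_imp_closed[OF assms(1)])
  then have "{x - y | x y. x \<in> measure_supp \<mu>\<^sub>s \<and> y \<in> measure_supp \<mu>\<^sub>s} \<subseteq> ?D"
    using SAP_part_supp_differences[OF assms(1,2) A \<mu> _ assms(7)] by blast
  with D have FLC: "FLC (measure_supp \<mu>\<^sub>s)"
    unfolding FLC_def by (rule locally_finite_subset)
  have pps: "pure_point \<mu>\<^sub>s"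
    by (rule pure_point_if_locally_finite_supp[OF assms(1) \<mu>s FLC_imp_locally_finite[OF FLC]])
  have "FLC (measure_supp \<mu>)"
    using D by (simp add: FLC_def)
  then have "pure_point \<mu>"
    by (rule pure_point_if_locally_finite_supp[OF assms(1) \<mu> FLC_imp_locally_finite])
  then have "pure_point \<mu>\<^sub>0"
    by (rule pure_point_diff[OF _ pps]) (simp add: sum)
  then show ?thesis
    using pps FLC by blast
qed

end
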